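(* Let $k \ge 2$, let $a_1, a_2, \dots, a_k$ be positive integers with $\gcd(a_1, a_2, \dots, a_k) = 1$, and let $s \ge 0$ be an integer. For $0 \le j \le a_1 - 1$, let $n_{j,s}$ denote the least nonnegative integer congruent to $j \pmod{a_1}$ that has more than $s$ representations in terms of $a_1, \dots, a_k$. Then \[ g^*_s(a_1, a_2, \dots, a_k) = \Bigl( \max_{0 \le j \le a_1 - 1} n_{j,s} \Bigr) - a_1 . \]
   Context: A representation of an integer $x$ in terms of $a_1, \dots, a_k$ is a $k$-tuple $(m_1, \dots, m_k) \in \mathbb{Z}_{\ge 0}^k$ with $x = m_1 a_1 + \dots + m_k a_k$; the number of representations of $x$ is the number of such tuples (so negative integers have $0$ representations). For an integer $s \ge 0$, $g^*_s(a_1, \dots, a_k)$ denotes the largest integer (possibly negative) that has at most $s$ representations in terms of $a_1, \dots, a_k$. *)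

theory Defs
  imports "HOL-Library.FuncSet" "HOL-Number_Theory.Cong"
begin

text \<open>A \<open>k\<close>-tuple is a function on the index set \<open>{1..k}\<close>; extensionality (\<open>\<rightarrow>\<^sub>E\<close>) makes
  the representation of a tuple unique, so that tuples can be counted.\<close>

definition representations :: "nat \<Rightarrow> (nat \<Rightarrow> int) \<Rightarrow> int \<Rightarrow> (nat \<Rightarrow> nat) set" where
  "representations k a x =
     {m \<in> {1..k} \<rightarrow>\<^sub>E UNIV. x = (\<Sum>i=1..k. int (m i) * a i)}"

text \<open>For positive \<open>a 1, \<dots>, a k\<close> the set of representations is finite (each \<open>m i\<close> is at most
  \<open>x\<close>), so the convention that \<open>card\<close> is \<open>0\<close> on infinite sets is not in play.\<close>

definition num_reps :: "nat \<Rightarrow> (nat \<Rightarrow> int) \<Rightarrow> int \<Rightarrow> nat" where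
  "num_reps k a x = card (representations k a x)"

text \<open>\<open>GREATEST\<close> and \<open>LEAST\<close> over \<open>int\<close> are unspecified if the extremum does not exist. For
  \<open>k \<ge> 2\<close> and positive \<open>a 1, \<dots>, a k\<close> with greatest common divisor \<open>1\<close> both extrema below
  exist: negative integers have no representations, and all sufficiently large integers have
  more than \<open>s\<close>.\<close>

definition g_star :: "nat \<Rightarrow> nat \<Rightarrow> (nat \<Rightarrow> int) \<Rightarrow> int" where
  "g_star s k a = (GREATEST x. num_reps k a x \<le> s)"

definition least_in_class :: "nat \<Rightarrow> nat \<Rightarrow> (nat \<Rightarrow> int) \<Rightarrow> int \<Rightarrow> int" where
  "least_in_class s k a j = (LEAST n. 0 \<le> n \<and> [n = j] (mod a 1) \<and> s < num_reps k a n)"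

end

theory Submission
  imports Defs
begin

text \<open>Adding one copy of \<open>a 1\<close> embeds the representations of \<open>x\<close> into those of \<open>x + a 1\<close>. So in
  each residue class modulo \<open>a 1\<close> the integers with more than \<open>s\<close> representations form a final
  segment of the class, starting at \<open>n j\<close>, and the largest member of the class with at most \<open>s\<close>
  representations is \<open>n j - a 1\<close>. The final segment is nonempty: by Bezout, some \<open>y\<close> in the
  class is representable, and \<open>y + s * a 1 * a 2\<close> then has \<open>s + 1\<close> representations, obtained
  by adding \<open>t * a 2\<close> copies of \<open>a 1\<close> and \<open>(s - t) * a 1\<close> copies of \<open>a 2\<close>.\<close>

lemma bezout_Gcd_int:
  fixes a :: "'i \<Rightarrow> int"
  assumes "finite I"
  shows "\<exists>c. (\<Sum>i\<in>I. c i * a i) = Gcd (a ` I)"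
  using assms
proof (induction I)
  case empty
  then show ?case by simp
next
  case (insert i I)
  then obtain c where c: "(\<Sum>l\<in>I. c l * a l) = Gcd (a ` I)" by blast
  obtain u v where uv: "u * a i + v * Gcd (a ` I) = gcd (a i) (Gcd (a ` I))"
    using bezout_int by blast
  \<comment> \<open>The two-term identity for \<open>a i\<close> and the gcd over \<open>I\<close>
    dictates the coefficients: \<open>u\<close> for the new index, the old ones scaled by
    \<open>v\<close>.\<close>
  let ?d = "\<lambda>l. if l = i then u else v * c l"
  have "(\<Sum>l\<in>I. ?d l * a l) = (\<Sum>l\<in>I. v * (c l * a l))"
    using insert.hyps by (intro sum.cong) auto
  also have "\<dots> = v * Gcd (a ` I)"
    by (simp add: c flip: sum_distrib_left)
  finally have "(\<Sum>l\<in>insert i I. ?d l * a l) = Gcd (a ` insert i I)"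
    using insert.hyps uv by simp
  then show ?case by (intro exI[of _ ?d])
qed

text \<open>An injection bounds \<open>card\<close> only when its target is finite, so this is what
  lets the embeddings below yield inequalities between counts.\<close>

lemma finite_representations:
  assumes pos: "\<And>i. i \<in> {1..k} \<Longrightarrow> a i > 0"
  shows "finite (representations k a x)"
proof (rule finite_subset)
  show "representations k a x \<subseteq> {1..k} \<rightarrow>\<^sub>E {..nat x}"
  proof
    fix m assume "m \<in> representations k a x"
    then have m: "m \<in> {1..k} \<rightarrow>\<^sub>E UNIV" and x: "x = (\<Sum>i=1..k. int (m i) * a i)"
      by (auto simp: representations_def)
    have "m i \<le> nat x" if "i \<in> {1..k}" for i
    proof -
      have "int (m i) * 1 \<le> int (m i) * a i"
        using pos[OF that] by (intro mult_left_mono) auto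
      also have "\<dots> \<le> x"
        unfolding x using that pos by (intro member_le_sum mult_nonneg_nonneg) (simp_all add: less_imp_le)
      finally show ?thesis by simp
    qed
    then show "m \<in> {1..k} \<rightarrow>\<^sub>E {..nat x}"
      using m by (auto simp: PiE_iff)
  qed
qed (simp add: finite_PiE)

lemma num_reps_neg:
  assumes "\<And>i. i \<in> {1..k} \<Longrightarrow> a i > 0" and "x < 0"
  shows "num_reps k a x = 0"
proof -
  have "(\<Sum>i=1..k. int (m i) * a i) \<ge> 0" for m :: "nat \<Rightarrow> nat"
    using assms(1) by (intro sum_nonneg mult_nonneg_nonneg) (simp_all add: less_imp_le)
  with assms(2) have "representations k a x = {}"
    by (auto simp: representations_def not_less[symmetric])
  then show ?thesis by (simp add: num_reps_def)
qed

lemma sum_fun_upd_add: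
  fixes a :: "'i \<Rightarrow> int" and m :: "'i \<Rightarrow> nat"
  assumes "finite I" "i \<in> I"
  shows "(\<Sum>l\<in>I. int ((m(i := m i + d)) l) * a l) = (\<Sum>l\<in>I. int (m l) * a l) + int d * a i"
proof -
  have "(\<Sum>l\<in>I - {i}. int ((m(i := m i + d)) l) * a l) = (\<Sum>l\<in>I - {i}. int (m l) * a l)"
    by (intro sum.cong) auto
  then show ?thesis
    using assms by (simp add: sum.remove algebra_simps)
qed

lemma representations_fun_upd:
  assumes "m \<in> representations k a x" "i \<in> {1..k}"
  shows "m(i := m i + d) \<in> representations k a (x + int d * a i)"
  using assms sum_fun_upd_add[of "{1..k}" i m d a]
  by (auto simp: representations_def PiE_iff extensional_def)

lemma num_reps_add_mono:
  assumes pos: "\<And>i. i \<in> {1..k} \<Longrightarrow> a i > 0" and i: "i \<in> {1..k}"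
  shows "num_reps k a x \<le> num_reps k a (x + int d * a i)"
  unfolding num_reps_def
proof (rule card_inj_on_le)
  show "inj_on (\<lambda>m. m(i := m i + d)) (representations k a x)"
  proof (rule inj_onI)
    fix m m' :: "nat \<Rightarrow> nat"
    assume eq: "m(i := m i + d) = m'(i := m' i + d)"
    show "m = m'"
    proof
      fix l show "m l = m' l"
        using fun_cong[OF eq, of l] by (cases "l = i") auto
    qed
  qed
  show "(\<lambda>m. m(i := m i + d)) ` representations k a x \<subseteq> representations k a (x + int d * a i)"
    using representations_fun_upd[OF _ i] by blast
qed (rule finite_representations[OF pos])

lemma exists_representable_in_class:
  assumes k: "k \<ge> 1" and pos: "\<And>i. i \<in> {1..k} \<Longrightarrow> a i > 0" and gcd: "Gcd (a ` {1..k}) = 1"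
  shows "\<exists>y. [y = j] (mod a 1) \<and> representations k a y \<noteq> {}"
proof -
  obtain c where c: "(\<Sum>i=1..k. c i * a i) = 1"
    using bezout_Gcd_int[of "{1..k}" a] gcd by auto
  \<comment> \<open>The Bezout coefficients scaled by \<open>j\<close> combine to \<open>j\<close>
    but may be negative. Reducing each one modulo \<open>a 1\<close> makes it nonnegative and keeps
    the sum in the class of \<open>j\<close>.\<close>
  define m where "m = restrict (\<lambda>i. nat (j * c i mod a 1)) {1..k}"
  have a1: "a 1 > 0" using pos k by simp
  have "[(\<Sum>i=1..k. int (m i) * a i) = (\<Sum>i=1..k. j * c i * a i)] (mod a 1)"
    using a1 by (intro cong_sum cong_mult) (auto simp: m_def cong_def)
  also have "(\<Sum>i=1..k. j * c i * a i) = j"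
    using c by (simp add: mult.assoc flip: sum_distrib_left)
  finally have "[(\<Sum>i=1..k. int (m i) * a i) = j] (mod a 1)" .
  moreover have "m \<in> representations k a (\<Sum>i=1..k. int (m i) * a i)"
    by (auto simp: representations_def m_def)
  ultimately show ?thesis by blast
qed

lemma exists_many_reps_in_class:
  assumes k: "k \<ge> 2" and pos: "\<And>i. i \<in> {1..k} \<Longrightarrow> a i > 0" and gcd: "Gcd (a ` {1..k}) = 1"
  shows "\<exists>n. [n = j] (mod a 1) \<and> s < num_reps k a n"
proof -
  obtain y m where y: "[y = j] (mod a 1)" and m: "m \<in> representations k a y"
    using exists_representable_in_class[of k a j] assms by auto
  have a1: "a 1 > 0" and a2: "a 2 > 0" using pos k by auto
  define n where "n = y + int s * a 2 * a 1"
  define f where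
    "f t = (m(1 := m 1 + t * nat (a 2)))(2 := m 2 + (s - t) * nat (a 1))" for t
  have "f t \<in> representations k a n" if "t \<le> s" for t
  proof -
    let ?m = "m(1 := m 1 + t * nat (a 2))"
    have "?m(2 := ?m 2 + (s - t) * nat (a 1)) \<in> representations k a
        (y + int (t * nat (a 2)) * a 1 + int ((s - t) * nat (a 1)) * a 2)"
      using k by (intro representations_fun_upd m) auto
    moreover have "y + int (t * nat (a 2)) * a 1 + int ((s - t) * nat (a 1)) * a 2 = n"
      using a1 a2 that by (simp add: n_def of_nat_diff algebra_simps)
    ultimately show ?thesis by (simp add: f_def)
  qed
  then have "f ` {..s} \<subseteq> representations k a n" by blast
  moreover have "inj_on f {..s}"
  proof (rule inj_onI)
    fix t t' assume "f t = f t'"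
    \<comment> \<open>Coordinate 1 of \<open>f t\<close> is \<open>m 1 + t * nat (a 2)\<close>, and
      this determines \<open>t\<close> since \<open>a 2\<close> is positive.\<close>
    from fun_cong[OF this, of 1] show "t = t'"
      using a2 by (simp add: f_def)
  qed
  ultimately have "card {..s} \<le> num_reps k a n"
    unfolding num_reps_def by (intro card_inj_on_le finite_representations[OF pos])
  moreover have "[n = j] (mod a 1)"
    using y by (simp add: n_def cong_def)
  ultimately show ?thesis by auto
qed

lemma least_in_class:
  fixes k s :: nat
  assumes "k \<ge> 2" and pos: "\<And>i. i \<in> {1..k} \<Longrightarrow> a i > 0" and "Gcd (a ` {1..k}) = 1"
  defines "n j \<equiv> least_in_class s k a j"
  shows "[n j = j] (mod a 1)"
    and "[x = j] (mod a 1) \<Longrightarrow> s < num_reps k a x \<longleftrightarrow> n j \<le> x"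
proof -
  define P where "P n \<longleftrightarrow> 0 \<le> n \<and> [n = j] (mod a 1) \<and> s < num_reps k a n" for n
  \<comment> \<open>The clause \<open>0 \<le> n\<close> of \<open>P\<close> comes for free: a
    negative integer has no representations, hence not more than \<open>s\<close>.\<close>
  have P: "P x" if "[x = j] (mod a 1)" "s < num_reps k a x" for x
    using num_reps_neg[OF pos, where x = x] that by (cases "x < 0") (auto simp: P_def)
  obtain n0 where "P n0"
    using exists_many_reps_in_class[of k a j s] assms P by blast
  then have n0: "P (int (nat n0))" by (auto simp: P_def)
  \<comment> \<open>The order on \<open>int\<close> is not well-founded, so the minimum is taken
    over \<open>nat\<close> and carried back; nothing is lost, as \<open>P\<close> holds only for
    nonnegative integers.\<close>
  define l where "l = (LEAST n. P (int n))"
  have l: "P (int l)" unfolding l_def by (rule LeastI[of "\<lambda>n. P (int n)", OF n0])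
  have l_le: "int l \<le> y" if "P y" for y
  proof -
    have "P (int (nat y))" using that by (auto simp: P_def)
    then have "l \<le> nat y" unfolding l_def by (rule Least_le)
    then show ?thesis using that by (auto simp: P_def)
  qed
  have "n j = int l"
    unfolding n_def least_in_class_def P_def[symmetric]
    using l l_le by (rule Least_equality)
  then have nP: "P (n j)" and n_le: "\<And>y. P y \<Longrightarrow> n j \<le> y"
    using l l_le by auto
  show cong: "[n j = j] (mod a 1)" using nP by (simp add: P_def)
  show "s < num_reps k a x \<longleftrightarrow> n j \<le> x" if x: "[x = j] (mod a 1)"
  proof
    assume "n j \<le> x"
    have a1: "a 1 > 0" using pos \<open>k \<ge> 2\<close> by simp
    \<comment> \<open>Within the class, \<open>x\<close> is reached from \<open>n j\<close> by
      adding \<open>a 1\<close> a nonnegative number of times, which never lowers the count.\<close>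
    have "a 1 dvd x - n j"
      using x cong by (metis cong_iff_dvd_diff cong_sym cong_trans)
    then obtain d where d: "x - n j = a 1 * d" by blast
    with \<open>n j \<le> x\<close> a1 have "d \<ge> 0"
      by (metis diff_ge_0_iff_ge zero_le_mult_iff not_less)
    with d have "x = n j + int (nat d) * a 1" by (simp add: algebra_simps)
    then show "s < num_reps k a x"
      using num_reps_add_mono[where a = a and k = k and i = 1 and x = "n j" and d = "nat d"] pos nP \<open>k \<ge> 2\<close>
      by (auto simp: P_def)
  qed (use n_le P x in blast)
qed

theorem lemma2:
  fixes k s :: nat and a :: "nat \<Rightarrow> int"
  assumes "k \<ge> 2"
    and "\<And>i. i \<in> {1..k} \<Longrightarrow> a i > 0"
    and "Gcd (a ` {1..k}) = 1"
  shows "g_star s k a = Max ((\<lambda>j. least_in_class s k a j) ` {0..a 1 - 1}) - a 1"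
proof -
  define n where "n = least_in_class s k a"
  define M where "M = Max (n ` {0..a 1 - 1})"
  note n_cong = least_in_class(1)[OF assms, where s = s, folded n_def]
  note n_iff = least_in_class(2)[OF assms, where s = s, folded n_def]
  have a1: "a 1 > 0" using assms(1,2) by simp
  have "M \<in> n ` {0..a 1 - 1}"
    unfolding M_def using a1 by (intro Max_in) auto
  then obtain j where j: "M = n j" by blast
  have "g_star s k a = M - a 1"
    unfolding g_star_def
  proof (rule Greatest_equality)
    \<comment> \<open>\<open>M - a 1\<close> is the member of class \<open>j\<close> just below
      \<open>n j\<close>, so it still has at most \<open>s\<close> representations.\<close>
    have "[M - a 1 = j] (mod a 1)"
      using n_cong[of j] by (simp add: j cong_def)
    then show "num_reps k a (M - a 1) \<le> s"
      using n_iff[of "M - a 1" j] a1 by (simp add: j)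
  next
    fix x assume x: "num_reps k a x \<le> s"
    \<comment> \<open>In its own class, \<open>x\<close> lies strictly below \<open>n i\<close>;
      being congruent to it, it lies below by at least \<open>a 1\<close>. As a remainder,
      \<open>i\<close> is among the indices of the maximum, so \<open>n i\<close> is at most
      \<open>M\<close>.\<close>
    define i where "i = x mod a 1"
    have xi: "[x = i] (mod a 1)" by (simp add: i_def cong_def)
    with x have "x < n i" using n_iff[of x i] by simp
    moreover have "a 1 dvd n i - x"
      using xi n_cong[of i] by (metis cong_iff_dvd_diff cong_sym cong_trans)
    ultimately have "a 1 \<le> n i - x" by (intro zdvd_imp_le) auto
    moreover have "n i \<le> M"
      unfolding M_def using a1 by (intro Max_ge) (auto simp: i_def)
    ultimately show "x \<le> M - a 1" by simp
  qed
  then show ?thesis by (simp add: M_def n_def)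
qed

end
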